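(* Let $\Sigma = \{0,1,2,3\}$. There is a finite set $F \subset \mathrm{Aut}(\Sigma^{\mathbb{Z}})$ such that for every $g \in \mathrm{Aut}(\Sigma^{\mathbb{Z}})$, we have $g \in \langle \sigma \rangle$ if and only if $f \circ g = g \circ f$ for all $f \in F$.
   Context: $\Sigma^{\mathbb{Z}}$ has the product topology ($\Sigma$ discrete), and the shift is $\sigma(x)_i = x_{i+1}$. $\mathrm{Aut}(\Sigma^{\mathbb{Z}})$ is the group, under composition, of homeomorphisms $f : \Sigma^{\mathbb{Z}} \to \Sigma^{\mathbb{Z}}$ commuting with $\sigma$, and $\langle \sigma \rangle = \{\sigma^n \mid n \in \mathbb{Z}\}$. *)

theory Defs
  imports "HOL-Analysis.Analysis" "HOL-Algebra.Group"
begin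

text \<open>
  The alphabet is the type \<^typ>\<open>'a\<close>; configurations are functions \<^typ>\<open>int \<Rightarrow> 'a\<close>. The topology is
  given explicitly rather than by the type class instance for functions, so that no topological
  structure on the alphabet other than the discrete one can interfere.
\<close>

definition full_shift :: "(int \<Rightarrow> 'a) topology" where
  "full_shift = product_topology (\<lambda>_. discrete_topology UNIV) UNIV"

definition shift :: "(int \<Rightarrow> 'a) \<Rightarrow> (int \<Rightarrow> 'a)" where
  "shift x = (\<lambda>i. x (i + 1))"

definition Aut :: "((int \<Rightarrow> 'a) \<Rightarrow> (int \<Rightarrow> 'a)) monoid" where
  "Aut = \<lparr>carrier = {f. homeomorphic_map full_shift full_shift f \<and> f \<circ> shift = shift \<circ> f},
          monoid.mult = (\<circ>), one = id\<rparr>"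

definition shift_powers :: "((int \<Rightarrow> 'a) \<Rightarrow> (int \<Rightarrow> 'a)) set" where
  "shift_powers = {shift [^]\<^bsub>Aut\<^esub> n | n :: int. True}"

lemma topspace_full_shift [simp]: "topspace full_shift = UNIV"
  by (simp add: full_shift_def)

lemma Aut_simps [simp]:
  "f \<in> carrier Aut \<longleftrightarrow> homeomorphic_map full_shift full_shift f \<and> f \<circ> shift = shift \<circ> f"
  "f \<otimes>\<^bsub>Aut\<^esub> g = f \<circ> g"
  "\<one>\<^bsub>Aut\<^esub> = id"
  by (simp_all add: Aut_def)

lemma group_Aut: "group (Aut :: ((int \<Rightarrow> 'a) \<Rightarrow> (int \<Rightarrow> 'a)) monoid)"
proof (rule groupI)
  fix f g :: "(int \<Rightarrow> 'a) \<Rightarrow> (int \<Rightarrow> 'a)"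
  assume f: "f \<in> carrier Aut" and g: "g \<in> carrier Aut"
  have "(f \<circ> g) \<circ> shift = shift \<circ> (f \<circ> g)"
    using f g by (metis Aut_simps(1) comp_assoc)
  then show "f \<otimes>\<^bsub>Aut\<^esub> g \<in> carrier Aut"
    using f g homeomorphic_map_compose by auto
next
  fix f :: "(int \<Rightarrow> 'a) \<Rightarrow> (int \<Rightarrow> 'a)"
  assume f: "f \<in> carrier Aut"
  then obtain g where fg: "homeomorphic_maps full_shift full_shift f g"
    by (auto simp: homeomorphic_map_maps)
  then have 1: "f \<circ> g = id" and 2: "g \<circ> f = id"
    by (auto simp: homeomorphic_maps_def)
  have "homeomorphic_map full_shift full_shift g"
    using fg homeomorphic_maps_map by blast
  moreover have "g \<circ> shift = shift \<circ> g"
  proof -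
    have "g \<circ> shift = g \<circ> (shift \<circ> f) \<circ> g" using 1 by (simp add: comp_assoc)
    also have "\<dots> = g \<circ> (f \<circ> shift) \<circ> g" using f by simp
    also have "\<dots> = (g \<circ> f) \<circ> (shift \<circ> g)" by (simp add: comp_assoc)
    finally show ?thesis using 2 by simp
  qed
  ultimately show "\<exists>g\<in>carrier Aut. g \<otimes>\<^bsub>Aut\<^esub> f = \<one>\<^bsub>Aut\<^esub>"
    using 2 by auto
qed (auto simp: comp_assoc)

lemma homeomorphic_map_translate:
  "homeomorphic_map full_shift full_shift (\<lambda>(x :: int \<Rightarrow> 'a) i. x (i + n))"
proof -
  have "continuous_map full_shift full_shift (\<lambda>(x :: int \<Rightarrow> 'a) i. x (i + m))" for m
    unfolding full_shift_def
    by (auto simp: continuous_map_componentwise_UNIV intro!: continuous_map_product_projection)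
  then have "homeomorphic_maps full_shift full_shift
      (\<lambda>(x :: int \<Rightarrow> 'a) i. x (i + n)) (\<lambda>x i. x (i + (- n)))"
    by (simp only: homeomorphic_maps_def) simp
  then show ?thesis
    using homeomorphic_map_maps by blast
qed

lemma shift_in_Aut: "shift \<in> carrier Aut"
  using homeomorphic_map_translate[of 1] by (simp add: shift_def [abs_def])

lemma shift_int_pow: "shift [^]\<^bsub>Aut\<^esub> (n :: int) = (\<lambda>(x :: int \<Rightarrow> 'a) i. x (i + n))"
proof -
  interpret group "Aut :: ((int \<Rightarrow> 'a) \<Rightarrow> (int \<Rightarrow> 'a)) monoid" by (rule group_Aut)
  have nat: "shift [^]\<^bsub>Aut\<^esub> k = (\<lambda>(x :: int \<Rightarrow> 'a) i. x (i + int k))" for k :: nat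
  proof (induction k)
    case 0
    then show ?case by (simp add: id_def)
  next
    case (Suc k)
    have "shift [^]\<^bsub>Aut\<^esub> Suc k = (\<lambda>(x :: int \<Rightarrow> 'a) i. x (i + int k)) \<circ> shift"
      by (simp only: nat_pow_Suc Suc Aut_simps(2))
    also have "\<dots> = (\<lambda>x i. x (i + int (Suc k)))"
      by (simp add: comp_def shift_def add_ac)
    finally show ?case .
  qed
  show ?thesis
  proof (cases "n \<ge> 0")
    case True
    then have "shift [^]\<^bsub>Aut\<^esub> n = (shift :: (int \<Rightarrow> 'a) \<Rightarrow> _) [^]\<^bsub>Aut\<^esub> nat n"
      by (simp only: int_pow_def2 not_less [symmetric] if_False)
    then show ?thesis
      using True by (simp only: nat int_nat_eq if_True)
  next
    case False
    let ?g = "\<lambda>(x :: int \<Rightarrow> 'a) i. x (i + n)"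
    have "?g \<circ> shift = shift \<circ> ?g"
      by (simp add: comp_def shift_def add_ac)
    then have g: "?g \<in> carrier Aut"
      using homeomorphic_map_translate[of n] by (simp only: Aut_simps)
    have p: "shift [^]\<^bsub>Aut\<^esub> nat (- n) \<in> carrier (Aut :: ((int \<Rightarrow> 'a) \<Rightarrow> _) monoid)"
      using shift_in_Aut by (rule nat_pow_closed)
    have "?g \<otimes>\<^bsub>Aut\<^esub> (shift [^]\<^bsub>Aut\<^esub> nat (- n)) = \<one>\<^bsub>Aut\<^esub>"
      using False by (simp only: nat Aut_simps) (simp add: comp_def id_def)
    then have "inv\<^bsub>Aut\<^esub> (shift [^]\<^bsub>Aut\<^esub> nat (- n)) = ?g"
      using g p inv_equality by blast
    then show ?thesis
      using False by (simp only: int_pow_def2 not_le if_True)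
  qed
qed

end

theory Submission
  imports Defs
begin

text \<open>
  Identify the alphabet with pairs of bits, so that a configuration is a pair of binary tracks.
  If \<open>g\<close> commutes with the shift of the second track alone, then the first track of the image cannot
  depend on the second track, since by continuity it would only see a finite window of it, which can
  be shifted away. Commuting with the swap of the tracks gives \<open>g = u \<times> u\<close>, and commuting with
  \<open>(x, y) \<mapsto> (x, x + y)\<close> and \<open>(x, y) \<mapsto> (x, y + x \<cdot> \<sigma>(x))\<close> makes \<open>u\<close> additive
  with \<open>u(x \<cdot> \<sigma>(x)) = u(x) \<cdot> \<sigma>(u(x))\<close>. If the finitely supported image of a
  single \<open>1\<close> had two or more \<open>1\<close>s, one could place two such images side by side so that the last \<open>1\<close> of
  the first is adjacent to the first \<open>1\<close> of the second, although the two original \<open>1\<close>s are at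
  distance at least two: a contradiction. So \<open>u\<close> is a shift on finite configurations, hence everywhere.
\<close>

section \<open>Continuity by finite windows, and commutation with translations\<close>

lemma continuous_map_full_shift_iff:
  fixes f :: "(int \<Rightarrow> 'a) \<Rightarrow> (int \<Rightarrow> 'b)"
  shows "continuous_map full_shift full_shift f \<longleftrightarrow>
    (\<forall>x i. \<exists>S. finite S \<and> (\<forall>y. (\<forall>j\<in>S. y j = x j) \<longrightarrow> f y i = f x i))"
    (is "_ \<longleftrightarrow> ?R")
proof
  assume cont: "continuous_map full_shift full_shift f"
  show ?R
  proof (intro allI)
    fix x :: "int \<Rightarrow> 'a" and i :: int
    have "continuous_map full_shift (discrete_topology UNIV) (\<lambda>y. f y i)"
      using cont by (simp add: full_shift_def continuous_map_componentwise_UNIV)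
    then have "openin full_shift {y. f y i \<in> {f x i}}"
      using openin_continuous_map_preimage [of _ _ _ "{f x i}"] by fastforce
    \<comment> \<open>A basic neighbourhood of \<open>x\<close> restricts only finitely many
      coordinates, and these serve as \<open>S\<close>.\<close>
    then obtain U where U: "finite {j. U j \<noteq> UNIV}" "x \<in> Pi\<^sub>E UNIV U"
      "Pi\<^sub>E UNIV U \<subseteq> {y. f y i \<in> {f x i}}"
      unfolding full_shift_def openin_product_topology_alt by auto
    have "f y i = f x i" if y: "\<forall>j\<in>{j. U j \<noteq> UNIV}. y j = x j" for y
    proof -
      have "y \<in> Pi\<^sub>E UNIV U" using U(2) y by fastforce
      then show ?thesis using U(3) by auto
    qed
    then show "\<exists>S. finite S \<and> (\<forall>y. (\<forall>j\<in>S. y j = x j) \<longrightarrow> f y i = f x i)"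
      using U(1) by blast
  qed
next
  assume R: ?R
  have "openin full_shift {x. f x i \<in> V}" for i V
    unfolding full_shift_def openin_product_topology_alt
  proof
    fix x assume x: "x \<in> {x. f x i \<in> V}"
    obtain S where S: "finite S" "\<And>y. (\<forall>j\<in>S. y j = x j) \<Longrightarrow> f y i = f x i"
      using R by blast
    let ?U = "\<lambda>j. if j \<in> S then {x j} else UNIV"
    have "finite {j. ?U j \<noteq> UNIV}"
      by (rule finite_subset [OF _ S(1)]) auto
    moreover have "Pi\<^sub>E UNIV ?U \<subseteq> {x. f x i \<in> V}"
    proof
      fix y assume y: "y \<in> Pi\<^sub>E UNIV ?U"
      have "y j = x j" if "j \<in> S" for j
        using PiE_mem [OF y, of j] that by simp
      then show "y \<in> {x. f x i \<in> V}"
        using S(2) [of y] x by simp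
    qed
    ultimately show "\<exists>U. finite {i \<in> UNIV. U i \<noteq> topspace (discrete_topology UNIV)} \<and>
        (\<forall>i\<in>UNIV. openin (discrete_topology UNIV) (U i)) \<and>
        x \<in> Pi\<^sub>E UNIV U \<and> Pi\<^sub>E UNIV U \<subseteq> {x. f x i \<in> V}"
      by (intro exI [of _ ?U]) auto
  qed
  then have "continuous_map full_shift (discrete_topology UNIV) (\<lambda>x. f x i)" for i
    by (simp add: continuous_map_def)
  then show "continuous_map full_shift full_shift f"
    by (simp add: full_shift_def continuous_map_componentwise_UNIV)
qed

text \<open>Serves maps given by a local rule: the window may vary with the output coordinate but
  not with the configuration, so it is in particular a window at every point.\<close>

lemma continuous_map_full_shift_window:
  assumes "\<And>i. finite (W i)" and "\<And>i x y. (\<And>j. j \<in> W i \<Longrightarrow> y j = x j) \<Longrightarrow> f y i = f x i"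
  shows "continuous_map full_shift full_shift f"
  unfolding continuous_map_full_shift_iff
proof (intro allI)
  fix x i
  have "\<forall>y. (\<forall>j\<in>W i. y j = x j) \<longrightarrow> f y i = f x i"
    by (intro allI impI assms(2)) simp
  with assms(1) show "\<exists>S. finite S \<and> (\<forall>y. (\<forall>j\<in>S. y j = x j) \<longrightarrow> f y i = f x i)"
    by (intro exI conjI)
qed

lemma Aut_intro:
  assumes "continuous_map full_shift full_shift f" "continuous_map full_shift full_shift f'"
    and "\<And>x. f' (f x) = x" "\<And>x. f (f' x) = x" "\<And>x. f (shift x) = shift (f x)"
  shows "f \<in> carrier Aut"
proof -
  have "homeomorphic_maps full_shift full_shift f f'"
    using assms by (simp add: homeomorphic_maps_def)
  then show ?thesis
    using assms(5) by (auto simp: homeomorphic_map_maps)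
qed

lemma translate_commute:
  assumes "f \<circ> shift = shift \<circ> f"
  shows "f (\<lambda>i. x (i + n)) = (\<lambda>i. f x (i + n))"
proof -
  have shift: "f (\<lambda>i. x (i + 1)) = (\<lambda>i. f x (i + 1))" for x
    using fun_cong [OF assms, of x] by (simp add: shift_def)
  show ?thesis
  proof (induction n arbitrary: x rule: int_induct [of _ 0])
    case base
    then show ?case by simp
  next
    case (step1 n)
    have "f (\<lambda>i. x (i + (n + 1))) = (\<lambda>i. f (\<lambda>i. x (i + n)) (i + 1))"
      using shift [of "\<lambda>i. x (i + n)"] by (simp add: add_ac)
    then show ?case
      using step1 by (simp add: add_ac)
  next
    case (step2 n)
    have "f (\<lambda>i. x (i + n)) = (\<lambda>i. f (\<lambda>i. x (i + (n - 1))) (i + 1))"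
      using shift [of "\<lambda>i. x (i + (n - 1))"] by (simp add: algebra_simps)
    then have "f x (i + n) = f (\<lambda>i. x (i + (n - 1))) (i + 1)" for i
      using step2 by metis
    \<comment> \<open>Evaluating at \<open>i - 1\<close> removes the one shift by which the two
      translates differ.\<close>
    from this [of "_ - 1"] show ?case
      by (auto simp: fun_eq_iff algebra_simps)
  qed
qed

lemma shift_powers_iff: "g \<in> shift_powers \<longleftrightarrow> (\<exists>n. g = (\<lambda>x i. x (i + n)))"
  by (simp add: shift_powers_def shift_int_pow)

lemma shift_powers_commute:
  assumes "g \<in> shift_powers" "f \<in> carrier Aut"
  shows "f \<circ> g = g \<circ> f"
proof -
  obtain n where "g = (\<lambda>x i. x (i + n))"
    using assms(1) by (auto simp: shift_powers_iff)
  moreover have "f \<circ> shift = shift \<circ> f"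
    using assms(2) by simp
  ultimately show ?thesis
    by (simp add: comp_def translate_commute)
qed

section \<open>Four automorphisms of the two-track full shift\<close>

definition shift_snd :: "(int \<Rightarrow> 'a \<times> 'b) \<Rightarrow> (int \<Rightarrow> 'a \<times> 'b)" where
  "shift_snd z = (\<lambda>i. (fst (z i), snd (z (i + 1))))"

definition swap_tracks :: "(int \<Rightarrow> 'a \<times> 'a) \<Rightarrow> (int \<Rightarrow> 'a \<times> 'a)" where
  "swap_tracks z = (\<lambda>i. prod.swap (z i))"

text \<open>Bits are elements of the field with two elements: \<noteq> on \<open>bool\<close> is
  addition and conjunction is multiplication.\<close>

definition add_fst :: "(int \<Rightarrow> bool \<times> bool) \<Rightarrow> (int \<Rightarrow> bool \<times> bool)" where
  "add_fst z = (\<lambda>i. (fst (z i), snd (z i) \<noteq> fst (z i)))"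

text \<open>The one nonlinear map among the four; it tells adjacent 1s from distant ones.\<close>

definition add_adjacent :: "(int \<Rightarrow> bool \<times> bool) \<Rightarrow> (int \<Rightarrow> bool \<times> bool)" where
  "add_adjacent z = (\<lambda>i. (fst (z i), snd (z i) \<noteq> (fst (z i) \<and> fst (z (i + 1)))))"

lemma shift_snd_in_Aut: "shift_snd \<in> carrier Aut"
proof (rule Aut_intro)
  show "continuous_map full_shift full_shift (shift_snd :: (int \<Rightarrow> 'a \<times> 'b) \<Rightarrow> _)"
    by (rule continuous_map_full_shift_window [where W = "\<lambda>i. {i, i + 1}"])
      (auto simp: shift_snd_def)
  show "continuous_map full_shift full_shift (\<lambda>(z :: int \<Rightarrow> 'a \<times> 'b) i. (fst (z i), snd (z (i - 1))))"
    by (rule continuous_map_full_shift_window [where W = "\<lambda>i. {i, i - 1}"]) auto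
qed (auto simp: shift_snd_def shift_def)

lemma swap_tracks_in_Aut: "swap_tracks \<in> carrier Aut"
proof (rule Aut_intro)
  show "continuous_map full_shift full_shift (swap_tracks :: (int \<Rightarrow> 'a \<times> 'a) \<Rightarrow> _)"
    by (rule continuous_map_full_shift_window [where W = "\<lambda>i. {i}"]) (auto simp: swap_tracks_def)
  \<comment> \<open>The map is an involution, so continuity of the inverse is the same fact;
    likewise for the two additions below.\<close>
  then show "continuous_map full_shift full_shift (swap_tracks :: (int \<Rightarrow> 'a \<times> 'a) \<Rightarrow> _)" .
qed (auto simp: swap_tracks_def shift_def)

lemma add_fst_in_Aut: "add_fst \<in> carrier Aut"
proof (rule Aut_intro)
  show "continuous_map full_shift full_shift add_fst"
    by (rule continuous_map_full_shift_window [where W = "\<lambda>i. {i}"]) (auto simp: add_fst_def)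
  then show "continuous_map full_shift full_shift add_fst" .
qed (auto simp: add_fst_def shift_def fun_eq_iff prod_eq_iff)

lemma add_adjacent_in_Aut: "add_adjacent \<in> carrier Aut"
proof (rule Aut_intro)
  show "continuous_map full_shift full_shift add_adjacent"
    by (rule continuous_map_full_shift_window [where W = "\<lambda>i. {i, i + 1}"])
      (auto simp: add_adjacent_def)
  then show "continuous_map full_shift full_shift add_adjacent" .
qed (auto simp: add_adjacent_def shift_def fun_eq_iff prod_eq_iff)

section \<open>The centralizer of the four automorphisms\<close>

lemma fst_image_independent_of_snd:
  fixes g :: "(int \<Rightarrow> 'a \<times> 'b) \<Rightarrow> (int \<Rightarrow> 'a \<times> 'b)"
  assumes cont: "continuous_map full_shift full_shift g"
    and comm: "shift_snd \<circ> g = g \<circ> shift_snd"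
    and same: "\<And>i. fst (z i) = fst (z' i)"
  shows "fst (g z i) = fst (g z' i)"
proof -
  obtain S where S: "finite S" "\<And>y. (\<forall>j\<in>S. y j = z j) \<Longrightarrow> g y i = g z i"
    using cont unfolding continuous_map_full_shift_iff by metis
  obtain S' where S': "finite S'" "\<And>y. (\<forall>j\<in>S'. y j = z' j) \<Longrightarrow> g y i = g z' i"
    using cont unfolding continuous_map_full_shift_iff by metis
  \<comment> \<open>Any \<open>n\<close> outside the finite set of differences makes
    \<open>S\<close> disjoint from \<open>S'\<close> translated by \<open>n\<close>.\<close>
  have "finite ((\<lambda>(a, b). a - b) ` (S \<times> S'))"
    using S(1) S'(1) by blast
  then have "\<not> range int \<subseteq> (\<lambda>(a, b). a - b) ` (S \<times> S')"
    using finite_subset [of "range int"] finite_imageD [of int UNIV] by auto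
  then obtain n where n: "int n \<notin> (\<lambda>(a, b). a - b) ` (S \<times> S')"
    by auto
  have disj: "j + int n \<notin> S" if "j \<in> S'" for j
  proof
    assume "j + int n \<in> S"
    then have "(\<lambda>(a, b). a - b) (j + int n, j) \<in> (\<lambda>(a, b). a - b) ` (S \<times> S')"
      using that by blast
    then show False using n by simp
  qed
  have pow: "(shift_snd ^^ k) y = (\<lambda>i. (fst (y i), snd (y (i + int k))))"
    for k and y :: "int \<Rightarrow> 'a \<times> 'b"
    by (induction k) (auto simp: shift_snd_def add_ac)
  have pow_comm: "g ((shift_snd ^^ k) y) = (shift_snd ^^ k) (g y)" for k y
    by (induction k) (simp_all add: comm [symmetric, unfolded fun_eq_iff comp_def, rule_format])
  \<comment> \<open>This hybrid looks like \<open>z\<close> on \<open>S\<close>, and after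
    \<open>n\<close> applications of \<open>shift_snd\<close> it looks like \<open>z'\<close> on
    \<open>S'\<close>. Those applications leave the first track of the image unchanged, so the two
    first tracks agree at \<open>i\<close>.\<close>
  let ?w = "\<lambda>j. if j \<in> S then z j else (fst (z j), snd (z' (j - int n)))"
  have "fst (g z i) = fst (g ?w i)"
    using S(2) [of ?w] by simp
  also have "\<dots> = fst (g ((shift_snd ^^ n) ?w) i)"
    unfolding pow_comm by (simp add: pow)
  also have "\<dots> = fst (g z' i)"
    using S'(2) [of "(shift_snd ^^ n) ?w"] same disj by (simp add: pow prod_eq_iff)
  finally show ?thesis .
qed

lemma centralizer_bool_pairs:
  fixes g :: "(int \<Rightarrow> bool \<times> bool) \<Rightarrow> (int \<Rightarrow> bool \<times> bool)"
  assumes g: "g \<in> carrier Aut"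
    and shift_snd: "shift_snd \<circ> g = g \<circ> shift_snd"
    and swap: "swap_tracks \<circ> g = g \<circ> swap_tracks"
    and add_fst: "add_fst \<circ> g = g \<circ> add_fst"
    and add_adjacent: "add_adjacent \<circ> g = g \<circ> add_adjacent"
  shows "g \<in> shift_powers"
proof -
  have homeo: "homeomorphic_map full_shift full_shift g" and gshift: "g \<circ> shift = shift \<circ> g"
    using g by simp_all
  then have cont: "continuous_map full_shift full_shift g" and inj: "inj g"
    by (simp_all add: homeomorphic_eq_everything_map)
  define u where "u x = (\<lambda>i. fst (g (\<lambda>i. (x i, False)) i))" for x :: "int \<Rightarrow> bool"
  have fst_g: "fst (g z i) = u (\<lambda>i. fst (z i)) i" for z i
    unfolding u_def by (rule fst_image_independent_of_snd [OF cont shift_snd]) simp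
  have snd_g: "snd (g z i) = u (\<lambda>i. snd (z i)) i" for z i
    \<comment> \<open>The swap turns the description of the first track into one of the second, with
      the same \<open>u\<close>.\<close>
    using fst_g [of "swap_tracks z" i] fun_cong [OF fun_cong [OF swap, of z], of i]
    by (simp add: swap_tracks_def prod_eq_iff)
  have u_add: "u (\<lambda>i. y i \<noteq> x i) = (\<lambda>i. u y i \<noteq> u x i)" for x y
  proof
    fix i
    show "u (\<lambda>i. y i \<noteq> x i) i = (u y i \<noteq> u x i)"
      using fun_cong [OF fun_cong [OF add_fst, of "\<lambda>i. (x i, y i)"], of i]
      by (simp add: add_fst_def prod_eq_iff fst_g snd_g)
  qed
  have u_zero: "u (\<lambda>i. False) = (\<lambda>i. False)"
    using u_add [of "\<lambda>i. False" "\<lambda>i. False"] by simp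
  have u_and: "u (\<lambda>i. x i \<and> x (i + 1)) = (\<lambda>i. u x i \<and> u x (i + 1))" for x
  proof
    fix i
    show "u (\<lambda>i. x i \<and> x (i + 1)) i = (u x i \<and> u x (i + 1))"
      \<comment> \<open>With a zero second track, \<open>add_adjacent\<close> leaves exactly the
        product there, and comparing second tracks isolates it.\<close>
      using fun_cong [OF fun_cong [OF add_adjacent, of "\<lambda>i. (x i, False)"], of i]
      by (simp add: add_adjacent_def prod_eq_iff fst_g snd_g u_zero)
  qed
  have u_translate: "u (\<lambda>i. x (i + n)) i = u x (i + n)" for x n i
    using translate_commute [OF gshift, of "\<lambda>i. (x i, False)" n] by (simp add: u_def)
  have u_cont: "\<exists>S. finite S \<and> (\<forall>y. (\<forall>j\<in>S. y j = x j) \<longrightarrow> u y i = u x i)" for x i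
  proof -
    obtain S where S: "finite S"
      "\<forall>z. (\<forall>j\<in>S. z j = (x j, False)) \<longrightarrow> g z i = g (\<lambda>j. (x j, False)) i"
      using cont [unfolded continuous_map_full_shift_iff, rule_format, of "\<lambda>j. (x j, False)" i]
      by blast
    have "u y i = u x i" if "\<forall>j\<in>S. y j = x j" for y
      using S(2) [rule_format, of "\<lambda>j. (y j, False)"] that by (simp add: u_def)
    then show ?thesis
      using S(1) by blast
  qed
  define p where "p = u (\<lambda>i. i = 0)"
  have u_single: "u (\<lambda>i. i = k) i = p (i - k)" for k i
    using u_translate [of "\<lambda>i. i = 0" "- k" i] by (simp add: p_def)
  \<comment> \<open>Continuity at the zero configuration gives a window \<open>S\<close> for
    coordinate 0. Since \<open>p i\<close> is the value at 0 of the image of a single 1 placed at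
    \<open>- i\<close>, that position must lie in \<open>S\<close>.\<close>
  have fin: "finite {i. p i}"
  proof -
    obtain S where S: "finite S" "\<And>y. (\<forall>j\<in>S. \<not> y j) \<Longrightarrow> \<not> u y 0"
      using u_cont [of "\<lambda>i. False" 0] u_zero by auto
    have "- i \<in> S" if "p i" for i
      using S(2) [of "\<lambda>j. j = - i"] that u_single [of "- i" 0] by auto
    then have "{i. p i} \<subseteq> uminus ` S"
      by force
    then show ?thesis
      using S(1) finite_subset by blast
  qed
  \<comment> \<open>The constant map to zero also commutes with all four automorphisms; injectivity
    of \<open>g\<close> excludes it.\<close>
  have ne: "{i. p i} \<noteq> {}"
  proof
    assume "{i. p i} = {}"
    then have "g (\<lambda>i. (i = 0, False)) = g (\<lambda>i. (False, False))"
      by (auto simp: fun_eq_iff prod_eq_iff fst_g snd_g u_zero simp flip: p_def)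
    then have "(\<lambda>i :: int. (i = 0, False)) = (\<lambda>i. (False, False))"
      using inj by (rule injD [rotated])
    then show False
      by (auto simp: fun_eq_iff)
  qed
  define a b where "a = Min {i. p i}" and "b = Max {i. p i}"
  have pa: "p a" and pb: "p b" and bounds: "\<And>i. p i \<Longrightarrow> a \<le> i \<and> i \<le> b"
    using Min_in [OF fin ne] Max_in [OF fin ne] fin by (auto simp: a_def b_def)
  have "a = b"
  proof (rule ccontr)
    assume "a \<noteq> b"
    then have "a < b"
      using bounds [OF pa] by simp
    \<comment> \<open>The copy of \<open>p\<close> moved by \<open>?k\<close> starts at
      \<open>b + 1\<close>, right after the last 1 of \<open>p\<close>. As \<open>a < b\<close>,
      \<open>?k\<close> is at least 2, so the 1s of \<open>?x\<close> are not adjacent.\<close>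
    let ?k = "b - a + 1"
    let ?x = "\<lambda>i. (i = 0) \<noteq> (i = ?k)"
    have ux: "u ?x i = (p i \<noteq> p (i - ?k))" for i
      by (simp only: u_add u_single) simp
    have "(\<lambda>i. u ?x i \<and> u ?x (i + 1)) = u (\<lambda>i. ?x i \<and> ?x (i + 1))"
      by (rule u_and [symmetric])
    also have "(\<lambda>i. ?x i \<and> ?x (i + 1)) = (\<lambda>i. False)"
    proof -
      have False if "?x i \<and> ?x (i + 1)" for i
      proof -
        have "i = 0 \<or> i = ?k" "i + 1 = 0 \<or> i + 1 = ?k"
          using that by blast+
        then show False
          using \<open>a < b\<close> by linarith
      qed
      then show ?thesis by blast
    qed
    finally have "\<not> (u ?x b \<and> u ?x (b + 1))"
      unfolding u_zero by (drule_tac x = b in fun_cong) simp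
    \<comment> \<open>Here \<open>b - ?k = a - 1\<close> and \<open>b + 1 - ?k = a\<close>, so the
      two copies do not cancel at \<open>b\<close> or \<open>b + 1\<close> and both coordinates
      carry a 1.\<close>
    moreover have "\<not> p (a - 1)" "\<not> p (b + 1)"
      using bounds by fastforce+
    ultimately show False
      using pa pb unfolding ux by simp
  qed
  then have p: "p i \<longleftrightarrow> i = a" for i
    using pa bounds [of i] by auto
  have u_finite: "u (\<lambda>i. i \<in> A) i \<longleftrightarrow> i - a \<in> A" if "finite A" for A i
    using that
  proof (induction A arbitrary: i)
    case empty
    then show ?case by (simp add: u_zero)
  next
    case (insert k A)
    then have "(\<lambda>i. i \<in> insert k A) = (\<lambda>i. (i = k) \<noteq> (i \<in> A))"
      by auto
    then have "u (\<lambda>i. i \<in> insert k A) i = (u (\<lambda>i. i = k) i \<noteq> u (\<lambda>i. i \<in> A) i)"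
      by (simp only: u_add)
    then show ?case
      using insert by (auto simp: u_single p)
  qed
  have u: "u x i = x (i - a)" for x i
  proof -
    obtain S where S: "finite S" "\<And>y. (\<forall>j\<in>S. y j = x j) \<Longrightarrow> u y i = u x i"
      using u_cont [of x i] by blast
    \<comment> \<open>Cutting \<open>x\<close> down to finite support keeps it intact on the window
      \<open>S\<close> and at \<open>i - a\<close>, where the claimed value is read.\<close>
    let ?A = "{j \<in> insert (i - a) S. x j}"
    have "u x i = u (\<lambda>j. j \<in> ?A) i"
      using S(2) [of "\<lambda>j. j \<in> ?A"] by simp
    also have "\<dots> = x (i - a)"
      using S(1) by (subst u_finite) auto
    finally show ?thesis .
  qed
  have "g = (\<lambda>z i. z (i + - a))"
    by (simp add: fun_eq_iff prod_eq_iff fst_g snd_g u)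
  then show ?thesis
    unfolding shift_powers_iff by blast
qed

section \<open>Conjugation by a bijection of alphabets\<close>

definition recode :: "('a \<Rightarrow> 'b) \<Rightarrow> ((int \<Rightarrow> 'a) \<Rightarrow> (int \<Rightarrow> 'a)) \<Rightarrow> ((int \<Rightarrow> 'b) \<Rightarrow> (int \<Rightarrow> 'b))" where
  "recode e f = (\<lambda>x. e \<circ> f (inv_into UNIV e \<circ> x))"

lemma recode_comp: "bij e \<Longrightarrow> recode e (f \<circ> g) = recode e f \<circ> recode e g"
  by (simp add: recode_def fun_eq_iff comp_def bij_is_inj)

lemma recode_id: "bij e \<Longrightarrow> recode e id = id"
  by (simp add: recode_def fun_eq_iff bij_is_surj surj_f_inv_f)

lemma recode_inv: "bij e \<Longrightarrow> recode e (recode (inv_into UNIV e) f) = f"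
  by (simp add: recode_def fun_eq_iff comp_def inv_inv_eq bij_is_surj surj_f_inv_f)

lemma recode_in_Aut:
  assumes e: "bij e" and f: "f \<in> carrier Aut"
  shows "recode e f \<in> carrier Aut"
proof -
  have cont: "continuous_map full_shift full_shift (recode e h)"
    if h: "continuous_map full_shift full_shift h" for h
    unfolding continuous_map_full_shift_iff
  proof (intro allI)
    fix x i
    obtain S where S: "finite S"
      "\<forall>y. (\<forall>j\<in>S. y j = (inv_into UNIV e \<circ> x) j) \<longrightarrow> h y i = h (inv_into UNIV e \<circ> x) i"
      using h [unfolded continuous_map_full_shift_iff, rule_format, of "inv_into UNIV e \<circ> x" i]
      by blast
    have "recode e h y i = recode e h x i" if "\<forall>j\<in>S. y j = x j" for y
      using S(2) [rule_format, of "inv_into UNIV e \<circ> y"] that by (simp add: recode_def)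
    then show "\<exists>S. finite S \<and> (\<forall>y. (\<forall>j\<in>S. y j = x j) \<longrightarrow> recode e h y i = recode e h x i)"
      using S(1) by blast
  qed
  obtain f' where f': "homeomorphic_maps full_shift full_shift f f'"
    using f by (auto simp: homeomorphic_map_maps)
  then have ff': "\<And>x. f' (f x) = x" "\<And>x. f (f' x) = x"
    by (auto simp: homeomorphic_maps_def)
  show ?thesis
  proof (rule Aut_intro)
    show "continuous_map full_shift full_shift (recode e f)"
      "continuous_map full_shift full_shift (recode e f')"
      using f' by (auto simp: homeomorphic_maps_def intro!: cont)
    fix x
    have "f' \<circ> f = id" "f \<circ> f' = id"
      using ff' by auto
    then have "recode e f' \<circ> recode e f = id" "recode e f \<circ> recode e f' = id"
      by (simp_all add: recode_id [OF e] flip: recode_comp [OF e])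
    then show "recode e f' (recode e f x) = x" "recode e f (recode e f' x) = x"
      by (simp_all add: pointfree_idE)
    have "f \<circ> shift = shift \<circ> f"
      using f by simp
    from translate_commute [OF this, of "inv_into UNIV e \<circ> x" 1]
    show "recode e f (shift x) = shift (recode e f x)"
      by (simp add: recode_def shift_def comp_def)
  qed
qed

text \<open>Powers of the shift move positions and leave letters alone, so the letterwise bijection
  cancels and the exponent stays the same.\<close>

lemma recode_shift_powers: "bij e \<Longrightarrow> g \<in> shift_powers \<Longrightarrow> recode e g \<in> shift_powers"
  by (auto simp: shift_powers_iff recode_def fun_eq_iff bij_is_surj surj_f_inv_f)

text \<open>Conjugation respects composition and shift powers, so the image of \<open>F\<close> does
  for \<open>'b\<close> what \<open>F\<close> does for \<open>'a\<close>. Only one inclusion is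
  assumed, since automorphisms always commute with shift powers.\<close>

lemma finite_Ryan_recode:
  fixes e :: "'a \<Rightarrow> 'b" and F :: "((int \<Rightarrow> 'a) \<Rightarrow> (int \<Rightarrow> 'a)) set"
  assumes e: "bij e" and F: "finite F" "F \<subseteq> carrier Aut"
    and centralizer: "\<And>g. g \<in> carrier Aut \<Longrightarrow> (\<And>f. f \<in> F \<Longrightarrow> f \<circ> g = g \<circ> f) \<Longrightarrow> g \<in> shift_powers"
  shows "\<exists>F :: ((int \<Rightarrow> 'b) \<Rightarrow> (int \<Rightarrow> 'b)) set. finite F \<and> F \<subseteq> carrier Aut \<and>
    (\<forall>g \<in> carrier Aut. g \<in> shift_powers \<longleftrightarrow> (\<forall>f \<in> F. f \<circ> g = g \<circ> f))"
proof (intro exI conjI ballI iffI)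
  show "finite (recode e ` F)"
    using F(1) by simp
  show sub: "recode e ` F \<subseteq> carrier Aut"
    using F(2) recode_in_Aut [OF e] by blast
  fix g :: "(int \<Rightarrow> 'b) \<Rightarrow> (int \<Rightarrow> 'b)"
  assume g: "g \<in> carrier Aut"
  show "f \<circ> g = g \<circ> f" if "g \<in> shift_powers" "f \<in> recode e ` F" for f
    using shift_powers_commute that sub by blast
  assume comm: "\<forall>f\<in>recode e ` F. f \<circ> g = g \<circ> f"
  have ie: "bij (inv_into UNIV e)"
    using e by (rule bij_imp_bij_inv)
  \<comment> \<open>Pull \<open>g\<close> back to the alphabet \<open>'a\<close>, where the
    centralizer is known.\<close>
  have "recode (inv_into UNIV e) g \<in> shift_powers"
  proof (rule centralizer)
    show "recode (inv_into UNIV e) g \<in> carrier Aut"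
      using ie g by (rule recode_in_Aut)
    fix f assume "f \<in> F"
    then have "recode (inv_into UNIV e) (recode e f \<circ> g) = recode (inv_into UNIV e) (g \<circ> recode e f)"
      using comm by simp
    moreover have "recode (inv_into UNIV e) (recode e f) = f"
      using recode_inv [OF ie, of f] e by (simp add: inv_inv_eq)
    ultimately show "f \<circ> recode (inv_into UNIV e) g = recode (inv_into UNIV e) g \<circ> f"
      by (simp add: recode_comp [OF ie])
  qed
  then show "g \<in> shift_powers"
    using recode_shift_powers [OF e] recode_inv [OF e] by metis
qed

theorem theorem2p2:
  shows "\<exists>F :: ((int \<Rightarrow> 4) \<Rightarrow> (int \<Rightarrow> 4)) set. finite F \<and> F \<subseteq> carrier Aut \<and>
    (\<forall>g \<in> carrier Aut. g \<in> shift_powers \<longleftrightarrow> (\<forall>f \<in> F. f \<circ> g = g \<circ> f))"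
proof -
  \<comment> \<open>Only the number of letters matters, so an arbitrary bijection with pairs of bits
    suffices.\<close>
  have "card (UNIV :: (bool \<times> bool) set) = card (UNIV :: 4 set)"
    by simp
  then obtain e :: "bool \<times> bool \<Rightarrow> 4" where "bij e"
    using finite_same_card_bij [of "UNIV :: (bool \<times> bool) set" "UNIV :: 4 set"] by auto
  then show ?thesis
  proof (rule finite_Ryan_recode)
    show "finite {shift_snd, swap_tracks, add_fst, add_adjacent}"
      by simp
    show "{shift_snd, swap_tracks, add_fst, add_adjacent} \<subseteq> carrier Aut"
      using shift_snd_in_Aut swap_tracks_in_Aut add_fst_in_Aut add_adjacent_in_Aut by blast
    show "g \<in> shift_powers"
      if "g \<in> carrier Aut"
        and comm: "\<And>f. f \<in> {shift_snd, swap_tracks, add_fst, add_adjacent} \<Longrightarrow> f \<circ> g = g \<circ> f"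
      for g
      using that(1) by (rule centralizer_bool_pairs; intro comm; blast)
  qed
qed

end
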